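(* Let $r=3$. If a bang-bang extremal trajectory has more than $4$ switchings, then it is not optimal in the sense that it does not come to the boundary of the attainable set: its endpoint lies in the interior of $\mathcal{A}$.
   Context: $G=\mathbb{R}^3\times\mathbb{R}^3$ is the free Carnot group of rank 3 and step 2, i.e. pairs of $x\in\mathbb{R}^3$ and a skew-symmetric $3\times3$ matrix $y=(y_{ij})$, with control system $\dot x_i=u_i$ ($i=1,2,3$), $\dot y_{ij}=x_iu_j-x_ju_i$ ($i<j$). $\mathcal{A}\subset G$ is the set of points reached from $(0,0)$ in some time $T\geqslant 0$ with controls $u\in L^\infty([0,T],\mathbb{R}^3)$, $u_1,u_2,u_3\geqslant0$. Let $U=\{u\in\mathbb{R}^3\mid u_1+u_2+u_3=1,\ u_i\geqslant0\}$ with vertices $e_1,e_2,e_3$. An extremal on $[0,T]$ consists of a measurable control $\tilde u:[0,T]\to U$ with the corresponding trajectory from $(0,0)$ (the extremal trajectory), a Lipschitz curve $h=(h_1,h_2,h_3)^T$ on $[0,T]$ and a constant skew-symmetric matrix $R=(h_{ij})$ such that for a.e. $t$: $\dot h(t)=R\tilde u(t)$ and $\sum_i\tilde u_i(t)h_i(t)=\max_{u\in U}\sum_iu_ih_i(t)=1$. The curve $h$ lies on the boundary of $Q=\{h\mid h_1,h_2,h_3\leqslant1\}$; let $E$ be the set of points of $Q$ with at least two coordinates equal to $1$ (the union of the edges of $Q$). The extremal (and its trajectory) is bang-bang if $\{t\in[0,T]\mid h(t)\in E\}$ is finite; then $\tilde u$ is (a.e.) piecewise constant with values in $\{e_1,e_2,e_3\}$,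 and a switching is a time in $(0,T)$ at which its value changes. *)

theory Defs
  imports "HOL-Analysis.Analysis"
begin

text \<open>Points \<open>(x, y)\<close> of the group; the skew-symmetric matrix \<open>y\<close> is given by its entries
  above the diagonal, in the order \<open>(y\<^sub>1\<^sub>2, y\<^sub>1\<^sub>3, y\<^sub>2\<^sub>3)\<close>.\<close>

type_synonym carnot = "(real^3) \<times> (real^3)"

definition velocity :: "carnot \<Rightarrow> real^3 \<Rightarrow> carnot" where
  "velocity q u = (let x = fst q in
     (u, vector [x$1 * u$2 - x$2 * u$1, x$1 * u$3 - x$3 * u$1, x$2 * u$3 - x$3 * u$2]))"

text \<open>Solutions of differential equations are Lipschitz curves satisfying the equation almost
  everywhere; as all controls are essentially bounded, these are exactly the absolutely continuous
  solutions.\<close>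

definition lipschitz_with_derivative ::
    "real \<Rightarrow> (real \<Rightarrow> 'a::euclidean_space) \<Rightarrow> (real \<Rightarrow> 'a) \<Rightarrow> bool" where
  "lipschitz_with_derivative T f f' \<longleftrightarrow>
     (\<exists>L. L-lipschitz_on {0..T} f) \<and>
     (AE t in lebesgue_on {0..T}. (f has_vector_derivative f' t) (at t within {0..T}))"

definition trajectory :: "real \<Rightarrow> (real \<Rightarrow> real^3) \<Rightarrow> (real \<Rightarrow> carnot) \<Rightarrow> bool" where
  "trajectory T u q \<longleftrightarrow>
     q 0 = (0, 0) \<and> lipschitz_with_derivative T q (\<lambda>t. velocity (q t) (u t))"

definition admissible_control :: "real \<Rightarrow> (real \<Rightarrow> real^3) \<Rightarrow> bool" where
  "admissible_control T u \<longleftrightarrow>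
     u \<in> borel_measurable (lebesgue_on {0..T}) \<and>
     (\<exists>B. AE t in lebesgue_on {0..T}. norm (u t) \<le> B) \<and>
     (AE t in lebesgue_on {0..T}. \<forall>i. 0 \<le> u t $ i)"

definition attainable_set :: "carnot set" where
  "attainable_set = {q T | T u q. 0 \<le> T \<and> admissible_control T u \<and> trajectory T u q}"

definition control_simplex :: "(real^3) set" where
  "control_simplex = {v. (\<Sum>i\<in>UNIV. v$i) = 1 \<and> (\<forall>i. 0 \<le> v$i)}"

definition extremal ::
    "real \<Rightarrow> (real \<Rightarrow> real^3) \<Rightarrow> (real \<Rightarrow> carnot) \<Rightarrow> (real \<Rightarrow> real^3) \<Rightarrow> real^3^3 \<Rightarrow> bool" where
  "extremal T u q h R \<longleftrightarrow>
     0 \<le> T \<and>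
     u \<in> borel_measurable (lebesgue_on {0..T}) \<and>
     (\<forall>t\<in>{0..T}. u t \<in> control_simplex) \<and>
     trajectory T u q \<and>
     transpose R = - R \<and>
     lipschitz_with_derivative T h (\<lambda>t. R *v u t) \<and>
     (AE t in lebesgue_on {0..T}.
        (\<forall>v\<in>control_simplex. (\<Sum>i\<in>UNIV. v$i * h t $ i) \<le> (\<Sum>i\<in>UNIV. u t $ i * h t $ i)) \<and>
        (\<Sum>i\<in>UNIV. u t $ i * h t $ i) = 1)"

definition Q_set :: "(real^3) set" where
  "Q_set = {p. \<forall>i. p$i \<le> 1}"

definition Q_edges :: "(real^3) set" where
  "Q_edges = {p \<in> Q_set. \<exists>i j. i \<noteq> j \<and> p$i = 1 \<and> p$j = 1}"

definition bang_bang :: "real \<Rightarrow> (real \<Rightarrow> real^3) \<Rightarrow> bool" where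
  "bang_bang T h \<longleftrightarrow> finite {t \<in> {0..T}. h t \<in> Q_edges}"

text \<open>The control is only determined almost everywhere, so a change of its value at \<open>s\<close> means
  that it is almost everywhere equal to one vertex of the simplex just before \<open>s\<close> and to another
  one just after \<open>s\<close>.  For an extremal, \<open>h s\<close> then lies on an edge by continuity of \<open>h\<close>; hence the
  set of switchings of a bang-bang extremal is finite and its cardinality is their number.\<close>

definition switchings :: "real \<Rightarrow> (real \<Rightarrow> real^3) \<Rightarrow> real set" where
  "switchings T u = {s. 0 < s \<and> s < T \<and>
     (\<exists>i j. \<exists>\<epsilon>>0. i \<noteq> j \<and>
        (AE t in lebesgue. t \<in> {s - \<epsilon><..<s} \<longrightarrow> u t = axis i 1) \<and>
        (AE t in lebesgue. t \<in> {s<..<s + \<epsilon>} \<longrightarrow> u t = axis j 1))}"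

end

theory Submission
  imports Defs
begin

text \<open>
  The trajectories of the control system are invariant under left translations of the group, and
  a constant control \<open>e\<^sub>i\<close> multiplies the current point from the right by \<open>exp(t e\<^sub>i)\<close>.  Hence all
  products of such \<^emph>\<open>axis arcs\<close> are attainable; they form a semigroup \<open>W\<close>, and the interior of \<open>W\<close> is
  stable under multiplication by elements of \<open>W\<close> from both sides.  It therefore suffices to find
  one stretch of the bang-bang trajectory whose increment is an interior point of \<open>W\<close>.

  While \<open>h\<close> is off the edges, exactly one coordinate \<open>h\<^sub>i\<close> equals \<open>1\<close>, so the control is \<open>e\<^sub>i\<close> and
  \<open>h\<close> moves with the constant velocity \<open>R e\<^sub>i\<close>.  A passage from \<open>e\<^sub>i\<close> to \<open>e\<^sub>j\<close> forces \<open>R\<^sub>j\<^sub>i > 0\<close>, hence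
  \<open>R\<^sub>i\<^sub>j < 0\<close>: the trajectory cannot return at once to \<open>e\<^sub>i\<close>, and the three controls are used in a fixed
  cyclic order.  Since \<open>h\<^sub>i\<close> has to come back to exactly \<open>1\<close> one cycle later, the durations of
  complete arcs are proportional to entries of \<open>R\<close>, so two complete arcs with the same control
  have the same duration (\<open>five_edge_points_interior\<close>).  After five switchings the trajectory thus
  contains the increment \<open>exp(A e\<^sub>i) exp(B e\<^sub>j) exp(C e\<^sub>k) exp(A e\<^sub>i) exp(b e\<^sub>j)\<close> with the \<^emph>\<open>same\<close> \<open>A\<close>.

  This increment has a second factorization, into six arcs with the controls \<open>i k i j k i\<close> and
  positive durations (\<open>five_arcs_interior\<close>).  No nonzero covector makes this sequence of
  controls satisfy the maximum principle, and products of this shape fill a neighbourhood: the six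
  durations can be recovered from the six coordinates of the product by continuous formulas
  (\<open>six_arcs_interior\<close>).
\<close>

section \<open>Lipschitz curves with a prescribed derivative almost everywhere\<close>

text \<open>The one-dimensional case of Sard's theorem, moved from \<open>real^1\<close> to \<open>real\<close>.\<close>

lemma negligible_image_zero_derivative:
  fixes f :: "real \<Rightarrow> real"
  assumes "\<And>t. t \<in> S \<Longrightarrow> (f has_vector_derivative 0) (at t)"
  shows "negligible (f ` S)"
proof -
  let ?v = "\<lambda>x. (\<chi> i. x) :: real^1"
  let ?F = "\<lambda>x::real^1. ?v (f (x$1))"
  have "negligible (?F ` (?v ` S))"
  proof (rule baby_Sard[where f' = "\<lambda>x h. 0"])
    fix x assume "x \<in> ?v ` S"
    then have "(f has_vector_derivative 0) (at (x$1))" using assms by auto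
    then have d: "(f has_derivative (\<lambda>h. 0)) (at (x$1) within UNIV)"
      by (simp add: has_vector_derivative_def)
    have g: "((\<lambda>x::real^1. x$1) has_derivative (\<lambda>h. h$1)) (at x within ?v ` S)"
      by (rule bounded_linear_imp_has_derivative) (rule bounded_linear_vec_nth)
    have "((\<lambda>x::real^1. f (x$1)) has_derivative (\<lambda>h. 0)) (at x within ?v ` S)"
      using has_derivative_in_compose[OF g has_derivative_subset[OF d subset_UNIV]] by simp
    then show "(?F has_derivative (\<lambda>h. 0)) (at x within ?v ` S)"
      by (subst has_derivative_componentwise_within) (auto simp: Basis_vec_def inner_axis)
  next
    fix x :: "real^1"
    show "rank (matrix (\<lambda>h::real^1. 0::real^1)) < CARD(1)"
      by (simp add: matrix_def rank_eq_0 vec_eq_iff)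
  qed auto
  then have "negligible ((\<lambda>x::real^1. x$1) ` ?F ` ?v ` S)"
  proof (rule negligible_locally_Lipschitz_image[rotated])
    fix x :: "real^1"
    have "norm (y$1 - x$1) \<le> 1 * norm (y - x)" for y
      by (metis component_le_norm_cart mult_1 real_norm_def vector_minus_component)
    then show "\<exists>T B. open T \<and> x \<in> T \<and> (\<forall>y\<in>?F ` ?v ` S \<inter> T. norm (y$1 - x$1) \<le> B * norm (y - x))"
      by (intro exI[of _ UNIV] exI[of _ 1]) auto
  qed simp
  moreover have "(\<lambda>x::real^1. x$1) ` ?F ` ?v ` S = f ` S" by (auto simp: image_image)
  ultimately show ?thesis by simp
qed

text \<open>The image of the points with zero derivative is negligible by Sard's theorem, and the image of
  the exceptional null set is negligible because \<open>f\<close> is Lipschitz.  So the image of the interval is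
  connected and negligible, that is, a single point.\<close>

lemma lipschitz_zero_derivative_AE_real:
  fixes f :: "real \<Rightarrow> real"
  assumes lip: "L-lipschitz_on {a..b} f"
    and ae: "AE t in lebesgue. t \<in> {a<..<b} \<longrightarrow> (f has_vector_derivative 0) (at t)"
    and t: "t \<in> {a..b}"
  shows "f t = f a"
proof (rule ccontr)
  assume ne: "f t \<noteq> f a"
  obtain N where N: "negligible N" "{t. \<not> (t \<in> {a<..<b} \<longrightarrow> (f has_vector_derivative 0) (at t))} \<subseteq> N"
    using ae unfolding eventually_ae_filter_negligible by blast
  have "negligible (f ` ({a<..<b} - N))"
    using N by (intro negligible_image_zero_derivative) auto
  moreover have "negligible (f ` (N \<inter> {a..b}))"
  proof (rule negligible_locally_Lipschitz_image)
    show "negligible (N \<inter> {a..b})" using N negligible_Int by blast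
    fix x assume "x \<in> N \<inter> {a..b}"
    then have "norm (f y - f x) \<le> L * norm (y - x)" if "y \<in> {a..b}" for y
      using lip that by (auto simp: lipschitz_on_def dist_norm)
    then show "\<exists>T B. open T \<and> x \<in> T \<and> (\<forall>y\<in>N \<inter> {a..b} \<inter> T. norm (f y - f x) \<le> B * norm (y - x))"
      by (intro exI[of _ UNIV] exI[of _ L]) auto
  qed simp
  ultimately have "negligible (f ` ({a<..<b} - N) \<union> f ` (N \<inter> {a..b}) \<union> {f a, f b})"
    by (intro negligible_Un) auto
  moreover have "f ` {a..b} \<subseteq> f ` ({a<..<b} - N) \<union> f ` (N \<inter> {a..b}) \<union> {f a, f b}"
  proof
    fix y assume "y \<in> f ` {a..b}"
    then obtain s where "s \<in> {a..b}" "y = f s" by blast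
    moreover then have "s \<in> {a<..<b} - N \<or> s \<in> N \<inter> {a..b} \<or> s = a \<or> s = b" by auto
    ultimately show "y \<in> f ` ({a<..<b} - N) \<union> f ` (N \<inter> {a..b}) \<union> {f a, f b}" by blast
  qed
  ultimately have neg: "negligible (f ` {a..b})" by (rule negligible_subset)
  have "connected (f ` {a..b})"
    by (intro connected_continuous_image connected_Icc lipschitz_on_continuous_on[OF lip])
  note between = connectedD_interval[OF this]
  have "{min (f a) (f t)<..<max (f a) (f t)} \<subseteq> f ` {a..b}"
  proof
    fix y assume "y \<in> {min (f a) (f t)<..<max (f a) (f t)}"
    then consider "f a \<le> y" "y \<le> f t" | "f t \<le> y" "y \<le> f a"
      by (auto simp: min_def max_def split: if_splits)
    then show "y \<in> f ` {a..b}"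
      using between[of "f a" "f t" y] between[of "f t" "f a" y] t by cases auto
  qed
  moreover have "{min (f a) (f t)<..<max (f a) (f t)} \<noteq> {}" using ne by (simp add: min_def max_def)
  ultimately show False
    using neg open_not_negligible[OF open_greaterThanLessThan] negligible_subset by metis
qed

lemma lipschitz_constant_derivative_AE:
  fixes f :: "real \<Rightarrow> 'a::euclidean_space"
  assumes lip: "L-lipschitz_on {a..b} f"
    and ae: "AE t in lebesgue. t \<in> {a<..<b} \<longrightarrow> (f has_vector_derivative c) (at t)"
    and t: "t \<in> {a..b}"
  shows "f t = f a + (t - a) *\<^sub>R c"
proof (rule euclidean_eqI)
  fix e :: 'a assume "e \<in> Basis"
  define g where "g s = (f s - s *\<^sub>R c) \<bullet> e" for s
  have "(L + norm c)-lipschitz_on {a..b} (\<lambda>s. f s - s *\<^sub>R c)"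
    by (intro lipschitz_on_diff lip lipschitz_onI) (auto simp: dist_norm simp flip: scaleR_diff_left)
  then have "(L + norm c)-lipschitz_on {a..b} g"
    unfolding g_def lipschitz_on_def
    by (auto simp: dist_norm simp flip: inner_diff_left intro: order_trans[OF Basis_le_norm[OF \<open>e \<in> Basis\<close>]])
  moreover have "AE t in lebesgue. t \<in> {a<..<b} \<longrightarrow> (g has_vector_derivative 0) (at t)"
    using ae
  proof eventually_elim
    case (elim t)
    show ?case
    proof
      assume "t \<in> {a<..<b}"
      with elim have "((\<lambda>s. f s - s *\<^sub>R c) has_vector_derivative (c - 1 *\<^sub>R c)) (at t)"
        by (auto intro!: derivative_eq_intros)
      then have "((\<lambda>s. (f s - s *\<^sub>R c) \<bullet> e) has_vector_derivative ((c - 1 *\<^sub>R c) \<bullet> e)) (at t)"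
        by (rule bounded_linear.has_vector_derivative[OF bounded_linear_inner_left])
      then show "(g has_vector_derivative 0) (at t)" by (simp add: g_def[abs_def])
    qed
  qed
  ultimately have "g t = g a" using t by (rule lipschitz_zero_derivative_AE_real)
  then show "f t \<bullet> e = (f a + (t - a) *\<^sub>R c) \<bullet> e"
    by (simp add: g_def inner_diff_left inner_add_left algebra_simps)
qed

text \<open>The complement of a null set is dense.\<close>

lemma AE_closed_imp_everywhere:
  fixes f :: "real \<Rightarrow> 'a::topological_space"
  assumes "a < b" "continuous_on {a..b} f" "closed C"
    and ae: "AE t in lebesgue. t \<in> {a<..<b} \<longrightarrow> f t \<in> C"
    and t: "t \<in> {a..b}"
  shows "f t \<in> C"
proof -
  define D where "D = {a<..<b} \<inter> f -` C"
  obtain N where N: "negligible N" "{t. \<not> (t \<in> {a<..<b} \<longrightarrow> f t \<in> C)} \<subseteq> N"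
    using ae unfolding eventually_ae_filter_negligible by blast
  have "{a<..<b} \<subseteq> closure D"
  proof
    fix s assume s: "s \<in> {a<..<b}"
    show "s \<in> closure D"
      unfolding closure_iff_nhds_not_empty
    proof (intro allI impI notI)
      fix A V assume V: "V \<subseteq> A" "open V" "s \<in> V" "D \<inter> A = {}"
      then have "V \<inter> {a<..<b} \<subseteq> N" using N(2) V(1,4) unfolding D_def by fastforce
      moreover have "open (V \<inter> {a<..<b})" using V by auto
      moreover have "V \<inter> {a<..<b} \<noteq> {}" using V s by auto
      ultimately show False using N(1) open_not_negligible negligible_subset by metis
    qed
  qed
  then have "closure {a<..<b} \<subseteq> closure D" by (simp add: closure_minimal)
  then have tD: "t \<in> closure D" using t \<open>a < b\<close> by auto
  have "closed ({a..b} \<inter> f -` C)"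
    using assms by (intro continuous_closed_preimage) auto
  moreover have "D \<subseteq> {a..b} \<inter> f -` C" unfolding D_def by auto
  ultimately show ?thesis using tD closure_minimal by blast
qed

lemma lipschitz_with_derivative_interior:
  assumes "lipschitz_with_derivative T f f'"
  shows "AE t in lebesgue. t \<in> {0<..<T} \<longrightarrow> (f has_vector_derivative f' t) (at t)"
proof -
  have "AE t in lebesgue. t \<in> {0..T} \<longrightarrow> (f has_vector_derivative f' t) (at t within {0..T})"
    using assms by (simp add: lipschitz_with_derivative_def AE_restrict_space_iff)
  then show ?thesis
    by eventually_elim (auto simp: at_within_Icc_at)
qed

lemma lipschitz_with_constant_derivative:
  assumes f: "lipschitz_with_derivative T f f'" and "0 \<le> a" "b \<le> T"
    and ae: "AE t in lebesgue. t \<in> {a<..<b} \<longrightarrow> f' t = c" and t: "t \<in> {a..b}"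
  shows "f t = f a + (t - a) *\<^sub>R c"
proof -
  obtain L where "L-lipschitz_on {0..T} f" using f by (auto simp: lipschitz_with_derivative_def)
  then have "L-lipschitz_on {a..b} f" by (rule lipschitz_on_subset) (use assms in auto)
  moreover have "AE t in lebesgue. t \<in> {a<..<b} \<longrightarrow> (f has_vector_derivative c) (at t)"
    using lipschitz_with_derivative_interior[OF f] ae
    by eventually_elim (use \<open>0 \<le> a\<close> \<open>b \<le> T\<close> in auto)
  ultimately show ?thesis using t by (rule lipschitz_constant_derivative_AE)
qed

section \<open>The group law and products of axis arcs\<close>

definition wedge :: "real^3 \<Rightarrow> real^3 \<Rightarrow> real^3" where
  "wedge x u = vector [x$1 * u$2 - x$2 * u$1, x$1 * u$3 - x$3 * u$1, x$2 * u$3 - x$3 * u$2]"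

text \<open>The group law: the area form of the left factor with the right one is what a path accumulates
  when it starts at the left factor instead of the origin.\<close>

definition carnot_mult :: "carnot \<Rightarrow> carnot \<Rightarrow> carnot" (infixl \<open>\<odot>\<close> 70) where
  "g \<odot> q = (fst g + fst q, snd g + snd q + wedge (fst g) (fst q))"

lemma velocity_wedge: "velocity q u = (u, wedge (fst q) u)"
  by (simp add: velocity_def wedge_def Let_def)

lemma bilinear_wedge: "bounded_bilinear wedge"
proof -
  have "bilinear wedge"
    unfolding bilinear_def wedge_def
    by (auto intro!: linearI simp: vec_eq_iff forall_3 algebra_simps)
  then show ?thesis using bilinear_conv_bounded_bilinear by blast
qed

lemmas wedge_add_left = bounded_bilinear.add_left[OF bilinear_wedge]
  and wedge_add_right = bounded_bilinear.add_right[OF bilinear_wedge]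
  and wedge_zero_left [simp] = bounded_bilinear.zero_left[OF bilinear_wedge]
  and wedge_zero_right [simp] = bounded_bilinear.zero_right[OF bilinear_wedge]
  and wedge_scaleR_left = bounded_bilinear.scaleR_left[OF bilinear_wedge]
  and wedge_scaleR_right = bounded_bilinear.scaleR_right[OF bilinear_wedge]
  and wedge_minus_left = bounded_bilinear.minus_left[OF bilinear_wedge]
  and wedge_minus_right = bounded_bilinear.minus_right[OF bilinear_wedge]

lemma wedge_self [simp]: "wedge x x = 0"
  by (simp add: wedge_def vec_eq_iff forall_3)

lemma carnot_mult_assoc: "p \<odot> q \<odot> r = p \<odot> (q \<odot> r)"
  by (simp add: carnot_mult_def wedge_add_left wedge_add_right)

lemma carnot_mult_one [simp]: "(0, 0) \<odot> q = q" "q \<odot> (0, 0) = q"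
  by (simp_all add: carnot_mult_def)

lemma carnot_mult_uminus [simp]: "- q \<odot> q = (0, 0)" "q \<odot> - q = (0, 0)"
  by (simp_all add: carnot_mult_def wedge_minus_left wedge_minus_right)

text \<open>The increment \<open>exp(t e\<^sub>i)\<close> of a trajectory during time \<open>t\<close> of the constant control \<open>e\<^sub>i\<close>.\<close>

definition axis_arc :: "3 \<Rightarrow> real \<Rightarrow> carnot" where
  "axis_arc i t = (t *\<^sub>R axis i 1, 0)"

lemma arc_zero [simp]: "axis_arc i 0 = (0, 0)"
  by (simp add: axis_arc_def)

inductive_set arc_products :: "carnot set" where
  one: "(0, 0) \<in> arc_products"
| arc: "g \<in> arc_products \<Longrightarrow> 0 \<le> t \<Longrightarrow> g \<odot> axis_arc i t \<in> arc_products"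

lemma arc_in_arc_products: "0 \<le> t \<Longrightarrow> axis_arc i t \<in> arc_products"
  using arc_products.arc[OF arc_products.one] by simp

lemma mult_in_arc_products:
  assumes "p \<in> arc_products" "q \<in> arc_products"
  shows "p \<odot> q \<in> arc_products"
  using assms(2)
proof induction
  case one
  then show ?case using assms(1) by simp
next
  case (arc g t i)
  then show ?case using arc_products.arc[of "p \<odot> g"] by (simp add: carnot_mult_assoc)
qed

text \<open>Two-sided translations are homeomorphisms that map the semigroup into itself.\<close>

lemma interior_arc_products_mult:
  assumes p: "p \<in> interior arc_products" and "g \<in> arc_products" "r \<in> arc_products"
  shows "g \<odot> p \<odot> r \<in> interior arc_products"
proof (rule interiorI)
  let ?f = "\<lambda>q. - g \<odot> q \<odot> - r"
  have "continuous_on UNIV ?f"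
    unfolding carnot_mult_def
    by (intro continuous_intros bounded_bilinear.continuous_on[OF bilinear_wedge])
  then show "open (?f -` interior arc_products)"
    using open_vimage open_interior by blast
  have "?f (g \<odot> p \<odot> r) = p"
    by (metis carnot_mult_assoc carnot_mult_one carnot_mult_uminus)
  then show "g \<odot> p \<odot> r \<in> ?f -` interior arc_products" using p by simp
  show "?f -` interior arc_products \<subseteq> arc_products"
  proof
    fix q assume "q \<in> ?f -` interior arc_products"
    then have "?f q \<in> arc_products" using interior_subset by auto
    then have "g \<odot> ?f q \<odot> r \<in> arc_products"
      using assms(2,3) mult_in_arc_products by blast
    moreover have "g \<odot> ?f q \<odot> r = q"
      by (metis carnot_mult_assoc carnot_mult_one carnot_mult_uminus)
    ultimately show "q \<in> arc_products" by simp
  qed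
qed

lemma fst_mult [simp]: "fst (g \<odot> q) = fst g + fst q"
  by (simp add: carnot_mult_def)

lemma mult_arc: "g \<odot> axis_arc i s = g + s *\<^sub>R velocity g (axis i 1)"
  by (simp add: carnot_mult_def axis_arc_def velocity_wedge wedge_scaleR_right prod_eq_iff)

lemma axis_nth_nonneg: "0 \<le> (axis i 1 :: real^3) $ j"
  by (simp add: axis_def)

lemma velocity_mult_arc: "velocity (g \<odot> axis_arc i s) (axis i 1) = velocity g (axis i 1)"
  by (simp add: velocity_wedge axis_arc_def wedge_add_left wedge_scaleR_left)

section \<open>Products of axis arcs are attainable\<close>

text \<open>The endpoints are excluded so that derivatives need to be computed at interior points only.\<close>

lemma AE_except_finite:
  fixes T :: real
  assumes "finite F" "\<And>t. t \<in> {0<..<T} - F \<Longrightarrow> P t"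
  shows "AE t in lebesgue_on {0..T}. P t"
proof -
  have "negligible (insert 0 (insert T F))" using assms(1) by (simp add: negligible_finite)
  moreover have "{t. \<not> (t \<in> {0..T} \<longrightarrow> P t)} \<subseteq> insert 0 (insert T F)" using assms(2) by force
  ultimately have "AE t in lebesgue. t \<in> {0..T} \<longrightarrow> P t"
    unfolding eventually_ae_filter_negligible by blast
  then show ?thesis by (simp add: AE_restrict_space_iff)
qed

text \<open>The induction appends one arc, so it keeps track of a control defined on the whole line and of
  a finite set \<open>F\<close> of times where the curve may have a corner; null sets appear only afterwards.\<close>

lemma piecewise_constant_control:
  assumes "g \<in> arc_products"
  shows "\<exists>T u q F L. 0 \<le> T \<and> u \<in> borel_measurable borel \<and> (\<forall>t. norm (u t) \<le> 1) \<and>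
     (\<forall>t i. 0 \<le> u t $ i) \<and> q 0 = (0, 0) \<and> q T = g \<and> L-lipschitz_on {0..T} q \<and> finite F \<and>
     (\<forall>t\<in>{0<..<T} - F. (q has_vector_derivative velocity (q t) (u t)) (at t))"
  using assms
proof induction
  case one
  show ?case
    by (intro exI[of _ "0::real"] exI[of _ "\<lambda>_. 0::real^3"] exI[of _ "\<lambda>_. (0, 0)::carnot"]
        exI[of _ "{}::real set"] exI[of _ "0::real"]) (auto intro: lipschitz_onI)
next
  case (arc g \<tau> i)
  then obtain T u q F L where T: "0 \<le> T" and u: "u \<in> borel_measurable borel"
    "\<And>t. norm (u t) \<le> 1" "\<And>t i. 0 \<le> u t $ i" and q: "q 0 = (0, 0)" "q T = g"
    "L-lipschitz_on {0..T} q" and F: "finite F"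
    "\<And>t. t \<in> {0<..<T} - F \<Longrightarrow> (q has_vector_derivative velocity (q t) (u t)) (at t)"
    by auto
  let ?v = "velocity g (axis i 1)"
  define u' where "u' s = (if s \<le> T then u s else axis i 1)" for s
  define q' where "q' s = (if s \<le> T then q s else g \<odot> axis_arc i (s - T))" for s
  have "(norm ?v)-lipschitz_on {T..T + \<tau>} (\<lambda>s. g \<odot> axis_arc i (s - T))"
    unfolding mult_arc
    by (intro lipschitz_onI) (auto simp: dist_norm mult.commute simp flip: scaleR_diff_left)
  with q have lip: "(max L (norm ?v))-lipschitz_on {0..T + \<tau>} q'"
    unfolding q'_def by (intro lipschitz_on_concat_max) auto
  have meas: "u' \<in> borel_measurable borel"
    unfolding u'_def using u(1) by measurable
  have deriv: "(q' has_vector_derivative velocity (q' s) (u' s)) (at s)"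
    if s: "s \<in> {0<..<T + \<tau>} - insert T F" for s
  proof (cases "s < T")
    case True
    then have "(q has_vector_derivative velocity (q s) (u s)) (at s)" using s F(2) by auto
    then have "(q' has_vector_derivative velocity (q s) (u s)) (at s)"
      by (rule has_vector_derivative_transform_within_open[where S = "{..<T}"])
        (use True in \<open>auto simp: q'_def\<close>)
    then show ?thesis using True by (simp add: q'_def u'_def)
  next
    case False
    then have "T < s" using s by auto
    have "((\<lambda>s. g + (s - T) *\<^sub>R ?v) has_vector_derivative ?v) (at s)"
      by (auto intro!: derivative_eq_intros)
    then have "(q' has_vector_derivative ?v) (at s)"
      by (rule has_vector_derivative_transform_within_open[where S = "{T<..}"])
        (use \<open>T < s\<close> in \<open>auto simp: q'_def mult_arc\<close>)
    then show ?thesis using \<open>T < s\<close> by (simp add: q'_def u'_def velocity_mult_arc)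
  qed
  show ?case
  proof (rule exI[of _ "T + \<tau>"], rule exI[of _ u'], rule exI[of _ q'],
      rule exI[of _ "insert T F"], rule exI[of _ "max L (norm ?v)"], intro conjI ballI allI)
    show "0 \<le> T + \<tau>" using T arc by simp
    show "q' 0 = (0, 0)" using T q by (simp add: q'_def)
    show "q' (T + \<tau>) = g \<odot> axis_arc i \<tau>" using q arc by (auto simp: q'_def)
    show "norm (u' t) \<le> 1" "0 \<le> u' t $ j" for t j
      using u(2)[of t] u(3)[of t j] by (simp_all add: u'_def axis_nth_nonneg)
    show "finite (insert T F)" using F by simp
  qed (fact meas lip deriv)+
qed

lemma arc_products_attainable: "arc_products \<subseteq> attainable_set"
proof
  fix g assume "g \<in> arc_products"
  from piecewise_constant_control[OF this]
  obtain T u q F L where T: "0 \<le> T" and u: "u \<in> borel_measurable borel"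
    "\<And>t. norm (u t) \<le> 1" "\<And>t i. 0 \<le> u t $ i" and q: "q 0 = (0, 0)" "q T = g"
    "L-lipschitz_on {0..T} q" and F: "finite F"
    "\<And>t. t \<in> {0<..<T} - F \<Longrightarrow> (q has_vector_derivative velocity (q t) (u t)) (at t)"
    by auto
  have "u \<in> borel_measurable (lebesgue_on {0..T})"
    using u(1) by (intro measurable_restrict_space1 measurable_completion) simp
  then have "admissible_control T u"
    unfolding admissible_control_def using u by auto
  moreover have "AE t in lebesgue_on {0..T}.
      (q has_vector_derivative velocity (q t) (u t)) (at t within {0..T})"
    by (rule AE_except_finite[OF F(1)]) (use F(2) in \<open>blast intro: has_vector_derivative_at_within\<close>)
  then have "trajectory T u q"
    unfolding trajectory_def lipschitz_with_derivative_def using q by blast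
  ultimately show "g \<in> attainable_set"
    unfolding attainable_set_def using T q by blast
qed

section \<open>Interior points of the semigroup of products\<close>

text \<open>The entry \<open>y\<^sub>a\<^sub>b\<close> of the skew-symmetric matrix stored in \<open>snd q\<close>, for any two indices; this makes the
  computations below uniform in the permutation \<open>(i, j, k)\<close> of the coordinates.\<close>

definition area :: "3 \<Rightarrow> 3 \<Rightarrow> carnot \<Rightarrow> real" where
  "area a b q = (let y = snd q in
     if (a, b) = (1, 2) then y$1 else if (a, b) = (2, 1) then - y$1
     else if (a, b) = (1, 3) then y$2 else if (a, b) = (3, 1) then - y$2
     else if (a, b) = (2, 3) then y$3 else if (a, b) = (3, 2) then - y$3 else 0)"

lemma area_mult:
  "area a b (g \<odot> q) = area a b g + area a b q + fst g $ a * fst q $ b - fst g $ b * fst q $ a"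
  using exhaust_3[of a] exhaust_3[of b]
  by (auto simp: area_def carnot_mult_def wedge_def)

lemma area_arc [simp]: "area a b (axis_arc i t) = 0"
  by (simp add: area_def axis_arc_def)

lemma fst_arc [simp]: "fst (axis_arc i t) $ a = (if a = i then t else 0)"
  by (simp add: axis_arc_def axis_def)

lemma carnot_eqI:
  fixes i j k :: 3
  assumes "i \<noteq> j" "j \<noteq> k" "i \<noteq> k"
    and "fst p $ i = fst q $ i" "fst p $ j = fst q $ j" "fst p $ k = fst q $ k"
    and "area i j p = area i j q" "area k j p = area k j q" "area k i p = area k i q"
  shows "p = q"
  using assms exhaust_3[of i] exhaust_3[of j] exhaust_3[of k]
  by (auto simp: prod_eq_iff vec_eq_iff forall_3 area_def)

lemma tendsto_area [tendsto_intros]: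
  "(f \<longlongrightarrow> q) F \<Longrightarrow> ((\<lambda>t. area a b (f t)) \<longlongrightarrow> area a b q) F"
  unfolding area_def Let_def by (auto intro!: tendsto_intros)

text \<open>The arguments \<open>i j k\<close> name the coordinates, while the controls are used in the order
  \<open>i k i j k i\<close>.\<close>

definition six_arcs :: "3 \<Rightarrow> 3 \<Rightarrow> 3 \<Rightarrow> real \<Rightarrow> real \<Rightarrow> real \<Rightarrow> real \<Rightarrow> real \<Rightarrow> real \<Rightarrow> carnot" where
  "six_arcs i j k p1 p2 p3 p4 p5 p6 =
     axis_arc i p1 \<odot> axis_arc k p2 \<odot> axis_arc i p3 \<odot> axis_arc j p4 \<odot> axis_arc k p5 \<odot> axis_arc i p6"

text \<open>The coordinates \<open>x\<^sub>j\<close>, \<open>x\<^sub>k\<close>, \<open>y\<^sub>k\<^sub>j\<close> of the product determine \<open>p4\<close>, \<open>p2 + p5\<close>, \<open>p2 - p5\<close>; the coordinates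
  \<open>x\<^sub>i\<close>, \<open>y\<^sub>i\<^sub>j\<close> determine \<open>p1 + p3\<close> and \<open>p6\<close>; finally \<open>y\<^sub>k\<^sub>i\<close> is an affine function of \<open>p1\<close> with slope
  \<open>- 2 * p2\<close>.  So the durations are continuous functions of the product near the given point, and
  they stay positive in a neighbourhood of it.\<close>

lemma six_arcs_interior:
  fixes i j k :: 3
  assumes ijk: "i \<noteq> j" "j \<noteq> k" "i \<noteq> k"
    and pos: "0 < p1" "0 < p2" "0 < p3" "0 < p4" "0 < p5" "0 < p6"
  shows "six_arcs i j k p1 p2 p3 p4 p5 p6 \<in> interior arc_products" (is "?p \<in> _")
proof -
  define X where "X a q = fst q $ a" for a and q :: carnot
  define P2 where "P2 q = (X k q + area k j q / X j q) / 2" for q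
  define P5 where "P5 q = (X k q - area k j q / X j q) / 2" for q
  define S where "S q = (X i q + area i j q / X j q) / 2" for q
  define P6 where "P6 q = (X i q - area i j q / X j q) / 2" for q
  define P1 where "P1 q = (P2 q * X i q - P5 q * (S q - P6 q) - area k i q) / (2 * P2 q)" for q
  define P3 where "P3 q = S q - P1 q" for q
  note P_defs = P2_def P5_def S_def P6_def
  have coords: "X i ?p = p1 + p3 + p6" "X j ?p = p4" "X k ?p = p2 + p5"
    using ijk by (auto simp: six_arcs_def X_def)
  have areas: "area k j ?p = p2 * p4 - p4 * p5" "area i j ?p = (p1 + p3) * p4 - p4 * p6"
    "area k i ?p = p2 * (p3 + p6) - p1 * p2 - (p1 + p3) * p5 + p5 * p6"
    using ijk by (auto simp: six_arcs_def area_mult algebra_simps)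
  have at: "P2 ?p = p2" "P5 ?p = p5" "S ?p = p1 + p3" "P6 ?p = p6"
    using pos by (simp_all add: P_defs coords areas field_simps)
  have at1: "P1 ?p = p1"
    unfolding P1_def at areas coords using pos by (simp add: field_simps)
  then have at3: "P3 ?p = p3" by (simp add: P3_def at)
  have limX: "(X a \<longlongrightarrow> X a ?p) (nhds ?p)" for a
    unfolding X_def by (intro tendsto_intros filterlim_ident)
  have limA: "(area a b \<longlongrightarrow> area a b ?p) (nhds ?p)" for a b
    by (intro tendsto_intros filterlim_ident)
  have nz: "X j ?p \<noteq> 0" "P2 ?p \<noteq> 0" using pos by (simp_all add: coords at)
  have lim2: "(P2 \<longlongrightarrow> P2 ?p) (nhds ?p)"
    unfolding P2_def by (intro tendsto_intros limX limA nz) simp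
  have lim5: "(P5 \<longlongrightarrow> P5 ?p) (nhds ?p)"
    unfolding P5_def by (intro tendsto_intros limX limA nz) simp
  have limS: "(S \<longlongrightarrow> S ?p) (nhds ?p)"
    unfolding S_def by (intro tendsto_intros limX limA nz) simp
  have lim6: "(P6 \<longlongrightarrow> P6 ?p) (nhds ?p)"
    unfolding P6_def by (intro tendsto_intros limX limA nz) simp
  have lim1: "(P1 \<longlongrightarrow> P1 ?p) (nhds ?p)"
    unfolding P1_def by (intro tendsto_intros limX limA lim2 lim5 limS lim6) (use nz in simp)
  have lim3: "(P3 \<longlongrightarrow> P3 ?p) (nhds ?p)"
    unfolding P3_def by (intro tendsto_intros lim1 limS)
  have "\<forall>\<^sub>F q in nhds ?p. 0 < P1 q \<and> 0 < P2 q \<and> 0 < P3 q \<and> 0 < X j q \<and> 0 < P5 q \<and> 0 < P6 q"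
    using pos
    by (intro eventually_conj order_tendstoD(1)[OF lim1] order_tendstoD(1)[OF lim2]
        order_tendstoD(1)[OF lim3] order_tendstoD(1)[OF lim5] order_tendstoD(1)[OF lim6]
        order_tendstoD(1)[OF limX]) (simp_all add: at at1 at3 coords)
  then have "\<forall>\<^sub>F q in nhds ?p. q \<in> arc_products"
  proof eventually_elim
    case (elim q)
    have "q = six_arcs i j k (P1 q) (P2 q) (P3 q) (X j q) (P5 q) (P6 q)" (is "q = ?q")
    proof (rule carnot_eqI[OF ijk])
      show "fst q $ i = fst ?q $ i" "fst q $ k = fst ?q $ k" "fst q $ j = fst ?q $ j"
        using ijk by (auto simp: six_arcs_def X_def P3_def P_defs field_simps)
      show "area k j q = area k j ?q" "area i j q = area i j ?q"
        using ijk elim by (auto simp: six_arcs_def area_mult P3_def P_defs field_simps)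
      have "2 * P2 q * P1 q = P2 q * X i q - P5 q * (S q - P6 q) - area k i q"
        using elim by (simp add: P1_def)
      moreover have "area k i ?q =
          P2 q * (P3 q + P6 q) - P1 q * P2 q - (P1 q + P3 q) * P5 q + P5 q * P6 q"
        using ijk by (auto simp: six_arcs_def area_mult algebra_simps)
      moreover have "X i q = S q + P6 q" by (simp add: P_defs field_simps)
      ultimately show "area k i q = area k i ?q" by (simp add: P3_def algebra_simps)
    qed
    moreover have "?q \<in> arc_products"
      unfolding six_arcs_def using elim
      by (intro mult_in_arc_products arc_in_arc_products) auto
    ultimately show ?case by simp
  qed
  then show ?thesis by (auto simp: eventually_nhds interior_def)
qed

text \<open>Shifting duration from the second pass through the cycle to the first, in proportion to the
  durations of complete arcs, leaves the endpoint unchanged to first order.  Here \<open>A * \<beta>\<close> is shifted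
  for \<open>i\<close>, \<open>C * \<beta>\<close> for \<open>k\<close>, whose arc in the first pass is created in this way, and the whole final
  arc \<open>b = \<beta> * (B + b)\<close> for \<open>j\<close>.  Only \<open>y\<^sub>k\<^sub>i\<close> is changed by this, by \<open>2 * A * C * \<beta>\<^sup>2\<close>, and moving
  the piece \<open>A * \<beta>\<close> of the first \<open>i\<close>-arc in front of the new \<open>k\<close>-arc corrects the change.\<close>

lemma five_arcs_interior:
  fixes i j k :: 3
  assumes ijk: "i \<noteq> j" "j \<noteq> k" "i \<noteq> k"
    and pos: "0 < A" "0 < B" "0 < C" "0 < b"
  shows "axis_arc i A \<odot> axis_arc j B \<odot> axis_arc k C \<odot> axis_arc i A \<odot> axis_arc j b \<in> interior arc_products"
proof -
  define \<beta> where "\<beta> = b / (B + b)"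
  have \<beta>: "0 < \<beta>" "\<beta> < 1" and b: "b = \<beta> * (B + b)"
    using pos by (simp_all add: \<beta>_def)
  let ?w = "axis_arc i A \<odot> axis_arc j B \<odot> axis_arc k C \<odot> axis_arc i A \<odot> axis_arc j b"
  let ?v = "six_arcs i j k (A * \<beta>) (C * \<beta>) A (B + b) (C * (1 - \<beta>)) (A * (1 - \<beta>))"
  have "?w = ?v"
  proof (rule carnot_eqI[OF ijk])
    show "fst ?w $ i = fst ?v $ i" "fst ?w $ k = fst ?v $ k" "fst ?w $ j = fst ?v $ j"
      using ijk by (auto simp: six_arcs_def algebra_simps)
    \<comment> \<open>The definition of \<open>\<beta>\<close> enters only through \<open>\<beta> * (B + b) = b\<close>, in the two areas with index \<open>j\<close>.\<close>
    have "area k j ?w = C * b - C * B" "area k j ?v = C * (2 * (\<beta> * (B + b))) - C * (B + b)"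
      using ijk by (auto simp: six_arcs_def area_mult algebra_simps)
    then show "area k j ?w = area k j ?v" unfolding b[symmetric] by (simp add: algebra_simps)
    have "area i j ?w = A * (2 * b)" "area i j ?v = A * (2 * (\<beta> * (B + b)))"
      using ijk by (auto simp: six_arcs_def area_mult algebra_simps)
    then show "area i j ?w = area i j ?v" unfolding b[symmetric] by simp
    show "area k i ?w = area k i ?v"
      using ijk by (auto simp: six_arcs_def area_mult algebra_simps)
  qed
  then show ?thesis using six_arcs_interior[OF ijk] pos \<beta> by simp
qed

section \<open>The cyclic structure of bang-bang extremals\<close>

lemma index_3_eqI: "l = k" if "i \<noteq> j" "j \<noteq> k" "i \<noteq> k" "l \<noteq> i" "l \<noteq> j" for i j k l :: 3
  using that exhaust_3[of i] exhaust_3[of j] exhaust_3[of k] exhaust_3[of l] by auto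

lemma next_element:
  fixes S :: "real set"
  assumes "finite S" "n < card (S \<inter> {z<..})"
  obtains z' where "z' \<in> S" "z < z'" "S \<inter> {z<..<z'} = {}" "n \<le> card (S \<inter> {z'<..})"
proof
  let ?A = "S \<inter> {z<..}" and ?m = "Min (S \<inter> {z<..})"
  have A: "finite ?A" "?A \<noteq> {}" using assms by auto
  show m: "?m \<in> S" "z < ?m" using Min_in[OF A] by auto
  show "S \<inter> {z<..<?m} = {}"
    using Min_le[OF A(1)] by (auto simp: not_less[symmetric])
  have "?A = insert ?m (S \<inter> {?m<..})"
    using m Min_le[OF A(1)] by (force simp: less_le)
  then have "card ?A = Suc (card (S \<inter> {?m<..}))"
    using assms(1) by (metis Int_iff card_insert_disjoint finite_Int greaterThan_iff less_irrefl)
  then show "n \<le> card (S \<inter> {?m<..})" using assms(2) by simp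
qed

locale extremal_curve =
  fixes T :: real and u :: "real \<Rightarrow> real^3" and q :: "real \<Rightarrow> carnot"
    and h :: "real \<Rightarrow> real^3" and R :: "real^3^3"
  assumes extremal: "extremal T u q h R" and T_pos: "0 < T"
begin

lemma R_skew: "R $ i $ j = - R $ j $ i"
proof -
  have "transpose R = - R" using extremal by (simp add: extremal_def)
  then have "transpose R $ j $ i = - R $ j $ i" by simp
  then show ?thesis by (simp add: transpose_def)
qed

lemma continuous_h: "continuous_on {0..T} h"
  using extremal lipschitz_on_continuous_on
  by (auto simp: extremal_def lipschitz_with_derivative_def)

text \<open>Testing the maximum condition with the vertices bounds every \<open>h\<^sub>i\<close> by \<open>1\<close>; then \<open>\<Sum>\<^sub>i u\<^sub>i (1 - h\<^sub>i) = 0\<close>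
  is a sum of nonnegative terms.\<close>

lemma maximum_AE:
  "AE t in lebesgue. t \<in> {0..T} \<longrightarrow> (\<forall>i. h t $ i \<le> 1) \<and> (\<forall>i. u t $ i \<noteq> 0 \<longrightarrow> h t $ i = 1)"
proof -
  have "AE t in lebesgue. t \<in> {0..T} \<longrightarrow>
        (\<forall>v\<in>control_simplex. (\<Sum>i\<in>UNIV. v$i * h t $ i) \<le> (\<Sum>i\<in>UNIV. u t $ i * h t $ i)) \<and>
        (\<Sum>i\<in>UNIV. u t $ i * h t $ i) = 1"
    using extremal unfolding extremal_def by (subst (asm) AE_restrict_space_iff) auto
  then show ?thesis
  proof eventually_elim
    case (elim t)
    show ?case
    proof
      assume t: "t \<in> {0..T}"
      have le: "h t $ i \<le> 1" for i
      proof -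
        have "axis i 1 \<in> control_simplex"
          by (simp add: control_simplex_def axis_def)
        then have "(\<Sum>k\<in>UNIV. axis i 1 $ k * h t $ k) \<le> 1" using elim t by fastforce
        then show ?thesis by (simp add: axis_def if_distrib[of "\<lambda>x. x * _"] cong: if_cong)
      qed
      have u: "u t \<in> control_simplex" using extremal t by (simp add: extremal_def)
      have "(\<Sum>i\<in>UNIV. u t $ i * (1 - h t $ i)) = 0"
        using elim t u by (simp add: right_diff_distrib sum_subtractf control_simplex_def)
      moreover have "0 \<le> u t $ i * (1 - h t $ i)" for i
        using u le by (simp add: control_simplex_def)
      ultimately have "u t $ i * (1 - h t $ i) = 0" for i
        by (simp add: sum_nonneg_eq_0_iff)
      then show "(\<forall>i. h t $ i \<le> 1) \<and> (\<forall>i. u t $ i \<noteq> 0 \<longrightarrow> h t $ i = 1)" using le by fastforce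
    qed
  qed
qed

lemma h_closed:
  assumes "closed C" "AE t in lebesgue. t \<in> {0..T} \<longrightarrow> h t \<in> C" "t \<in> {0..T}"
  shows "h t \<in> C"
proof (rule AE_closed_imp_everywhere[OF T_pos continuous_h assms(1) _ assms(3)])
  show "AE t in lebesgue. t \<in> {0<..<T} \<longrightarrow> h t \<in> C"
    using assms(2) by eventually_elim auto
qed

lemma h_le_1:
  assumes "t \<in> {0..T}"
  shows "h t $ i \<le> 1"
proof -
  have "h t \<in> {p. p $ i \<le> 1}"
  proof (rule h_closed[OF _ _ assms])
    show "closed ({p. p $ i \<le> 1} :: (real^3) set)"
      by (intro closed_Collect_le continuous_intros)
    show "AE t in lebesgue. t \<in> {0..T} \<longrightarrow> h t \<in> {p. p $ i \<le> 1}"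
      using maximum_AE by eventually_elim simp
  qed
  then show ?thesis by simp
qed

lemma h_on_face:
  assumes "t \<in> {0..T}"
  shows "\<exists>i. h t $ i = 1"
proof -
  have "h t \<in> (\<Union>i. {p. p $ i = 1})"
  proof (rule h_closed[OF _ _ assms])
    show "closed (\<Union>i. {p. p $ i = 1} :: (real^3) set)"
      by (intro closed_UN ballI closed_Collect_eq continuous_intros) simp
    show "AE t in lebesgue. t \<in> {0..T} \<longrightarrow> h t \<in> (\<Union>i. {p. p $ i = 1})"
      using maximum_AE
    proof eventually_elim
      case (elim t)
      show ?case
      proof
        assume t: "t \<in> {0..T}"
        have "(\<Sum>i\<in>UNIV. u t $ i) = 1" using extremal t by (auto simp: extremal_def control_simplex_def)
        then obtain i where "u t $ i \<noteq> 0" by (metis sum.neutral zero_neq_one)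
        then show "h t \<in> (\<Union>i. {p. p $ i = 1})" using elim t by auto
      qed
    qed
  qed
  then show ?thesis by auto
qed

lemma h_in_edges_iff:
  "t \<in> {0..T} \<Longrightarrow> h t \<in> Q_edges \<longleftrightarrow> (\<exists>i j. i \<noteq> j \<and> h t $ i = 1 \<and> h t $ j = 1)"
  using h_le_1 by (auto simp: Q_edges_def Q_set_def)

text \<open>An interval on which \<open>h\<close> stays in the relative interior of the face \<open>h\<^sub>i = 1\<close>.\<close>

definition face_arc :: "real \<Rightarrow> real \<Rightarrow> 3 \<Rightarrow> bool" where
  "face_arc a b i \<longleftrightarrow> 0 \<le> a \<and> a < b \<and> b \<le> T \<and> (\<forall>t\<in>{a<..<b}. \<forall>k. h t $ k = 1 \<longleftrightarrow> k = i)"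

text \<open>The sets of times with \<open>h\<^sub>i = 1\<close>, for the different \<open>i\<close>, are closed, disjoint and cover the
  connected interval.\<close>

lemma face_arc_exists:
  assumes ab: "0 \<le> a" "a < b" "b \<le> T" and no_edge: "\<And>t. t \<in> {a<..<b} \<Longrightarrow> h t \<notin> Q_edges"
  shows "\<exists>i. face_arc a b i"
proof -
  have unique: "i = j" if "t \<in> {a<..<b}" "h t $ i = 1" "h t $ j = 1" for t i j
    using no_edge[OF that(1)] h_in_edges_iff that ab by auto
  define m where "m = (a + b) / 2"
  have m: "m \<in> {a<..<b}" using ab by (auto simp: m_def)
  then obtain i where i: "h m $ i = 1" using h_on_face[of m] ab by auto
  have cont: "continuous_on {a<..<b} h"
    by (rule continuous_on_subset[OF continuous_h]) (use ab in auto)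
  let ?A = "{p. p $ i = 1} :: (real^3) set" and ?B = "(\<Union>j\<in>-{i}. {p. p $ j = 1}) :: (real^3) set"
  have "h t $ i = 1" if t: "t \<in> {a<..<b}" for t
  proof (rule ccontr)
    assume "h t $ i \<noteq> 1"
    moreover obtain j where "h t $ j = 1" using h_on_face[of t] t ab by auto
    ultimately have tB: "h t \<in> ?B" by auto
    have "closed ?A" "closed ?B"
      by (intro closed_UN ballI closed_Collect_eq continuous_intros; simp)+
    moreover have "connected (h ` {a<..<b})"
      by (intro connected_continuous_image cont) simp
    moreover have "h ` {a<..<b} \<subseteq> ?A \<union> ?B"
    proof
      fix p assume "p \<in> h ` {a<..<b}"
      then obtain s where "s \<in> {a<..<b}" "p = h s" by blast
      then have "s \<in> {0..T}" "p = h s" using ab by auto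
      then show "p \<in> ?A \<union> ?B" using h_on_face[of s] by auto
    qed
    moreover have "?A \<inter> ?B \<inter> h ` {a<..<b} = {}" using unique by fastforce
    moreover have "?A \<inter> h ` {a<..<b} \<noteq> {}" using i m by auto
    moreover have "?B \<inter> h ` {a<..<b} \<noteq> {}" using tB t by auto
    ultimately show False unfolding connected_closed by blast
  qed
  then have "face_arc a b i" unfolding face_arc_def using ab unique by blast
  then show ?thesis ..
qed

lemma face_arc_control:
  assumes "face_arc a b i"
  shows "AE t in lebesgue. t \<in> {a<..<b} \<longrightarrow> u t = axis i 1"
  using maximum_AE
proof eventually_elim
  case (elim t)
  show ?case
  proof
    assume "t \<in> {a<..<b}"
    then have t: "t \<in> {0..T}" and "\<And>k. h t $ k = 1 \<longleftrightarrow> k = i"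
      using assms by (auto simp: face_arc_def)
    then have other: "u t $ k = 0" if "k \<noteq> i" for k using elim that by auto
    have "(\<Sum>k\<in>UNIV. u t $ k) = 1" using extremal t by (auto simp: extremal_def control_simplex_def)
    moreover have "(\<Sum>k\<in>UNIV. u t $ k) = (\<Sum>k\<in>UNIV. if k = i then u t $ i else 0)"
      using other by (intro sum.cong) auto
    ultimately show "u t = axis i 1" using other by (auto simp: vec_eq_iff axis_def)
  qed
qed

lemma face_arc_h:
  assumes "face_arc a b i" "t \<in> {a..b}"
  shows "h t $ k = h a $ k + (t - a) * R $ k $ i"
proof -
  have "h t = h a + (t - a) *\<^sub>R (R *v axis i 1)"
  proof (rule lipschitz_with_constant_derivative)
    show "lipschitz_with_derivative T h (\<lambda>t. R *v u t)" using extremal by (simp add: extremal_def)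
    show "AE t in lebesgue. t \<in> {a<..<b} \<longrightarrow> R *v u t = R *v axis i 1"
      using face_arc_control[OF assms(1)] by eventually_elim auto
  qed (use assms in \<open>auto simp: face_arc_def\<close>)
  then show ?thesis by (simp add: matrix_vector_mul_component inner_axis column_def)
qed

lemma face_arc_active:
  assumes "face_arc a b i" "t \<in> {a..b}"
  shows "h t $ i = 1"
proof -
  have "R $ i $ i = 0" using R_skew[of i i] by simp
  then have const: "h s $ i = h a $ i" if "s \<in> {a..b}" for s
    using face_arc_h[OF assms(1) that, of i] by simp
  have "(a + b) / 2 \<in> {a<..<b}" using assms by (auto simp: face_arc_def)
  then have "h ((a + b) / 2) $ i = 1" "(a + b) / 2 \<in> {a..b}"
    using assms(1) by (auto simp: face_arc_def)
  then show ?thesis using const assms(2) by metis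
qed

text \<open>The first component moves along the axis, so the area form \<open>x \<and> e\<^sub>i\<close> is constant along the arc
  and the whole velocity is constant.\<close>

lemma face_arc_q:
  assumes "face_arc a b i"
  shows "q b = q a \<odot> axis_arc i (b - a)"
proof -
  have ab: "0 \<le> a" "a < b" "b \<le> T" using assms by (auto simp: face_arc_def)
  have traj: "lipschitz_with_derivative T q (\<lambda>t. velocity (q t) (u t))"
    using extremal by (simp add: extremal_def trajectory_def)
  have "lipschitz_with_derivative T (\<lambda>t. fst (q t)) u"
    unfolding lipschitz_with_derivative_def
  proof
    obtain L where "L-lipschitz_on {0..T} q" using traj by (auto simp: lipschitz_with_derivative_def)
    then have "L-lipschitz_on {0..T} (\<lambda>t. fst (q t))"
      unfolding lipschitz_on_def by (meson dist_fst_le order_trans)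
    then show "\<exists>L. L-lipschitz_on {0..T} (\<lambda>t. fst (q t))" ..
    have "AE t in lebesgue_on {0..T}.
        (q has_vector_derivative velocity (q t) (u t)) (at t within {0..T})"
      using traj by (simp add: lipschitz_with_derivative_def)
    then show "AE t in lebesgue_on {0..T}.
        ((\<lambda>t. fst (q t)) has_vector_derivative u t) (at t within {0..T})"
    proof eventually_elim
      case (elim t)
      from bounded_linear.has_vector_derivative[OF bounded_linear_fst this]
      show ?case by (simp add: velocity_wedge)
    qed
  qed
  then have x: "fst (q t) = fst (q a) + (t - a) *\<^sub>R axis i 1" if "t \<in> {a..b}" for t
    by (rule lipschitz_with_constant_derivative[OF _ _ _ face_arc_control[OF assms]])
      (use ab that in auto)
  have "q b = q a + (b - a) *\<^sub>R velocity (q a) (axis i 1)"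
  proof (rule lipschitz_with_constant_derivative[OF traj])
    show "AE t in lebesgue. t \<in> {a<..<b} \<longrightarrow> velocity (q t) (u t) = velocity (q a) (axis i 1)"
      using face_arc_control[OF assms]
    proof eventually_elim
      case (elim t)
      show ?case
      proof
        assume "t \<in> {a<..<b}"
        then have "u t = axis i 1" "fst (q t) = fst (q a) + (t - a) *\<^sub>R axis i 1"
          using elim x[of t] by auto
        then show "velocity (q t) (u t) = velocity (q a) (axis i 1)"
          by (simp add: velocity_wedge wedge_add_left wedge_scaleR_left)
      qed
    qed
  qed (use ab in auto)
  then show ?thesis by (simp add: mult_arc)
qed

text \<open>Before \<open>z\<close> the coordinates other than \<open>i\<close> are below \<open>1\<close>, so any of them that equals \<open>1\<close> at \<open>z\<close> grows
  at a positive rate on the first arc.  If the control did not change at \<open>z\<close>, that coordinate would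
  exceed \<open>1\<close> afterwards.\<close>

lemma switch_rate_pos:
  assumes l: "face_arc a z i" and r: "face_arc z b j" and edge: "h z \<in> Q_edges"
  shows "0 < R $ j $ i"
proof -
  have z: "z \<in> {0..T}" "a < z" "z < b" using l r by (auto simp: face_arc_def)
  have pos: "0 < R $ k $ i" if "k \<noteq> i" "h z $ k = 1" for k
  proof -
    define m where "m = (a + z) / 2"
    have m: "m \<in> {a<..<z}" using z by (simp add: m_def)
    then have "h m $ k \<noteq> 1" using l that by (auto simp: face_arc_def)
    moreover have "h m $ k \<le> 1" using h_le_1 m l by (auto simp: face_arc_def)
    ultimately have "h m $ k < h z $ k" using that by simp
    then have "(m - a) * R $ k $ i < (z - a) * R $ k $ i"
      using face_arc_h[OF l, of m k] face_arc_h[OF l, of z k] m by auto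
    then have "0 < (z - m) * R $ k $ i" by (simp add: algebra_simps)
    then show ?thesis using m by (simp add: zero_less_mult_iff)
  qed
  obtain k where k: "k \<noteq> i" "h z $ k = 1" using edge h_in_edges_iff[OF z(1)] by metis
  have "j \<noteq> i"
  proof
    assume "j = i"
    define m where "m = (z + b) / 2"
    have m: "m \<in> {z<..<b}" using z by (simp add: m_def)
    then have "h m $ k = 1 + (m - z) * R $ k $ i"
      using face_arc_h[OF r, of m k] k \<open>j = i\<close> by auto
    moreover have "0 < (m - z) * R $ k $ i" using pos[OF k] m by simp
    moreover have "h m $ k \<le> 1" using h_le_1 m r by (auto simp: face_arc_def)
    ultimately show False by simp
  qed
  moreover have "h z $ j = 1" using face_arc_active[OF r, of z] z by auto
  ultimately show ?thesis by (rule pos)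
qed

text \<open>On either side of a switching a different coordinate of \<open>h\<close> equals \<open>1\<close>; by continuity both do at
  the switching itself.\<close>

lemma switchings_subset: "switchings T u \<subseteq> {t \<in> {0<..<T}. h t \<in> Q_edges}"
proof
  fix s assume "s \<in> switchings T u"
  then obtain i j \<epsilon> where s: "0 < s" "s < T" and ij: "i \<noteq> j" and \<epsilon>: "\<epsilon> > 0"
    and left: "AE t in lebesgue. t \<in> {s - \<epsilon><..<s} \<longrightarrow> u t = axis i 1"
    and right: "AE t in lebesgue. t \<in> {s<..<s + \<epsilon>} \<longrightarrow> u t = axis j 1"
    by (auto simp: switchings_def)
  have active: "h s $ k = 1"
    if "a < b" "s \<in> {a..b}" "{a..b} \<subseteq> {0..T}" and ae: "AE t in lebesgue. t \<in> {a<..<b} \<longrightarrow> u t = axis k 1"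
    for a b k
  proof -
    have "h s \<in> {p. p $ k = 1}"
    proof (rule AE_closed_imp_everywhere[OF that(1) _ _ _ that(2)])
      show "continuous_on {a..b} h" using continuous_h that(3) by (rule continuous_on_subset)
      show "closed ({p. p $ k = 1} :: (real^3) set)"
        by (intro closed_Collect_eq continuous_intros)
      show "AE t in lebesgue. t \<in> {a<..<b} \<longrightarrow> h t \<in> {p. p $ k = 1}"
        using ae maximum_AE
      proof eventually_elim
        case (elim t)
        have "t \<in> {a<..<b} \<Longrightarrow> t \<in> {0..T}" using that(3) by force
        with elim show ?case by (auto simp: axis_def)
      qed
    qed
    then show ?thesis by simp
  qed
  have "h s $ i = 1"
  proof (rule active[of "max 0 (s - \<epsilon>)" s])
    show "AE t in lebesgue. t \<in> {max 0 (s - \<epsilon>)<..<s} \<longrightarrow> u t = axis i 1"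
      using left by eventually_elim auto
  qed (use s \<epsilon> in auto)
  moreover have "h s $ j = 1"
  proof (rule active[of s "min T (s + \<epsilon>)"])
    show "AE t in lebesgue. t \<in> {s<..<min T (s + \<epsilon>)} \<longrightarrow> u t = axis j 1"
      using right by eventually_elim auto
  qed (use s \<epsilon> in auto)
  ultimately show "s \<in> {t \<in> {0<..<T}. h t \<in> Q_edges}"
    using s ij h_in_edges_iff[of s] by auto
qed

text \<open>Split at the finitely many visits to the edges.\<close>

lemma q_arc_product:
  assumes "finite {t \<in> {0..T}. h t \<in> Q_edges}" "0 \<le> a" "a \<le> b" "b \<le> T"
  shows "\<exists>w\<in>arc_products. q b = q a \<odot> w"
  using assms
proof (induction "card {t \<in> {a<..<b}. h t \<in> Q_edges}" arbitrary: a b rule: less_induct)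
  case less
  let ?E = "\<lambda>a b. {t \<in> {a<..<b}. h t \<in> Q_edges}"
  have fin: "finite (?E a b)"
    by (rule finite_subset[OF _ less.prems(1)]) (use less.prems in auto)
  show ?case
  proof (cases "a < b \<and> ?E a b \<noteq> {}")
    case True
    then obtain z where z: "z \<in> ?E a b" by auto
    have "?E a z \<subset> ?E a b" "?E z b \<subset> ?E a b" using z by auto
    then have "card (?E a z) < card (?E a b)" "card (?E z b) < card (?E a b)"
      using psubset_card_mono[OF fin] by auto
    with less z obtain v w where "v \<in> arc_products" "w \<in> arc_products"
      "q z = q a \<odot> v" "q b = q z \<odot> w"
      by (metis (no_types, lifting) greaterThanLessThan_iff less_imp_le mem_Collect_eq order_trans)
    then show ?thesis using mult_in_arc_products carnot_mult_assoc by metis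
  next
    case False
    show ?thesis
    proof (cases "a = b")
      case True
      then show ?thesis using arc_products.one carnot_mult_one(2) by metis
    next
      case neq: False
      with False less.prems obtain i where "face_arc a b i"
        using face_arc_exists[of a b] by auto
      then show ?thesis
        using face_arc_q arc_in_arc_products[of "b - a" i] less.prems(3) by auto
    qed
  qed
qed

text \<open>Five edge points give six consecutive arcs with the controls \<open>k i j k i j\<close>.  The first one
  yields \<open>h\<^sub>k = 1\<close> at the first edge point, so that the change of \<open>h\<^sub>k\<close> is known over the next two arcs;
  the last one may be incomplete, and its length \<open>b\<close> in \<open>five_arcs_interior\<close> is arbitrary.\<close>

lemma five_edge_points_interior:
  assumes fin: "finite {t \<in> {0..T}. h t \<in> Q_edges}"
    and five: "4 < card {t \<in> {0<..<T}. h t \<in> Q_edges}"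
  shows "q T \<in> interior arc_products"
proof -
  \<comment> \<open>The end time \<open>T\<close> is added so that the sixth arc also ends at a point of \<open>S\<close>.\<close>
  define S where "S = insert T {t \<in> {0<..<T}. h t \<in> Q_edges}"
  have finS': "finite {t \<in> {0<..<T}. h t \<in> Q_edges}"
    by (rule finite_subset[OF _ fin]) auto
  then have finS: "finite S" by (simp add: S_def)
  have "S \<inter> {0<..} = S" using T_pos by (auto simp: S_def)
  then have "5 < card (S \<inter> {0<..})" using five finS' by (simp add: S_def)
  note nxt = next_element[OF finS]
  obtain z1 where z1: "z1 \<in> S" "0 < z1" "S \<inter> {0<..<z1} = {}" "5 \<le> card (S \<inter> {z1<..})"
    using nxt[of 5 0] \<open>5 < card (S \<inter> {0<..})\<close> by blast
  obtain z2 where z2: "z2 \<in> S" "z1 < z2" "S \<inter> {z1<..<z2} = {}" "4 \<le> card (S \<inter> {z2<..})"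
    using nxt[of 4 z1] z1(4) by auto
  obtain z3 where z3: "z3 \<in> S" "z2 < z3" "S \<inter> {z2<..<z3} = {}" "3 \<le> card (S \<inter> {z3<..})"
    using nxt[of 3 z2] z2(4) by auto
  obtain z4 where z4: "z4 \<in> S" "z3 < z4" "S \<inter> {z3<..<z4} = {}" "2 \<le> card (S \<inter> {z4<..})"
    using nxt[of 2 z3] z3(4) by auto
  obtain z5 where z5: "z5 \<in> S" "z4 < z5" "S \<inter> {z4<..<z5} = {}" "1 \<le> card (S \<inter> {z5<..})"
    using nxt[of 1 z4] z4(4) by auto
  obtain z6 where z6: "z6 \<in> S" "z5 < z6" "S \<inter> {z5<..<z6} = {}"
    using nxt[of 0 z5] z5(4) by auto
  have S_le: "z \<le> T" if "z \<in> S" for z using that by (auto simp: S_def)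
  have edge: "h z \<in> Q_edges" if "z \<in> S" "z < z6" for z
    using that S_le[OF z6(1)] by (auto simp: S_def)
  have arc: "\<exists>i. face_arc a b i" if "0 \<le> a" "a < b" "b \<in> S" "S \<inter> {a<..<b} = {}" for a b
  proof (rule face_arc_exists)
    fix t assume "t \<in> {a<..<b}"
    then have "t \<in> {0<..<T}" "t \<notin> S" using that S_le[of b] by auto
    then show "h t \<notin> Q_edges" by (auto simp: S_def)
  qed (use that S_le[of b] in auto)
  obtain k0 where k0: "face_arc 0 z1 k0" using arc[of 0 z1] z1 by auto
  obtain i where i: "face_arc z1 z2 i" using arc[of z1 z2] z1 z2 by auto
  obtain j where j: "face_arc z2 z3 j" using arc[of z2 z3] z1 z2 z3 by auto
  obtain k where k: "face_arc z3 z4 k" using arc[of z3 z4] z1 z2 z3 z4 by auto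
  obtain i' where i': "face_arc z4 z5 i'" using arc[of z4 z5] z1 z2 z3 z4 z5 by auto
  obtain j' where j': "face_arc z5 z6 j'" using arc[of z5 z6] z1 z2 z3 z4 z5 z6 by auto
  have rates: "0 < R $ i $ k0" "0 < R $ j $ i" "0 < R $ k $ j" "0 < R $ i' $ k" "0 < R $ j' $ i'"
    using switch_rate_pos[OF k0 i] switch_rate_pos[OF i j] switch_rate_pos[OF j k]
      switch_rate_pos[OF k i'] switch_rate_pos[OF i' j'] edge z1 z2 z3 z4 z5 z6 by auto
  have neq: "a \<noteq> b" if "0 < R $ a $ b" for a b using R_skew[of a b] that by auto
  have neq2: "a \<noteq> c" if "0 < R $ b $ a" "0 < R $ c $ b" for a b c using R_skew[of a b] that by auto
  have ijk: "i \<noteq> j" "j \<noteq> k" "i \<noteq> k"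
    using neq[OF rates(2)] neq[OF rates(3)] neq2[OF rates(2,3)] by auto
  have "k0 = k"
    using index_3_eqI[OF ijk] neq[OF rates(1)] neq2[OF rates(1,2)] by auto
  have "i' = i"
    using index_3_eqI[of j k i i'] ijk neq[OF rates(4)] neq2[OF rates(3,4)] by auto
  have "j' = j"
    using index_3_eqI[of k i j j'] ijk neq[OF rates(5)] neq2[OF rates(4,5)] \<open>i' = i\<close> by auto
  have "h z1 $ k = 1" "h z3 $ k = 1" "h z2 $ i = 1" "h z4 $ i = 1" "h z3 $ j = 1" "h z5 $ j = 1"
    using face_arc_active[OF k0, of z1] face_arc_active[OF k, of z3] face_arc_active[OF i, of z2]
      face_arc_active[OF i', of z4] face_arc_active[OF j, of z3] face_arc_active[OF j', of z5]
      \<open>k0 = k\<close> \<open>i' = i\<close> \<open>j' = j\<close> z1 z2 z3 z4 z5 z6 by auto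
  \<comment> \<open>Over one complete cycle each coordinate returns to \<open>1\<close>: \<open>h\<^sub>k\<close> between \<open>z1\<close> and \<open>z3\<close>, \<open>h\<^sub>i\<close> between \<open>z2\<close>
    and \<open>z4\<close>, \<open>h\<^sub>j\<close> between \<open>z3\<close> and \<open>z5\<close>.\<close>
  then have "(z2 - z1) * R $ k $ i + (z3 - z2) * R $ k $ j = 0"
    and "(z3 - z2) * R $ i $ j + (z4 - z3) * R $ i $ k = 0"
    and "(z4 - z3) * R $ j $ k + (z5 - z4) * R $ j $ i = 0"
    using face_arc_h[OF i, of z2 k] face_arc_h[OF j, of z3 k] face_arc_h[OF j, of z3 i]
      face_arc_h[OF k, of z4 i] face_arc_h[OF k, of z4 j] face_arc_h[OF i', of z5 j]
      \<open>i' = i\<close> z2 z3 z4 z5 by auto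
  then have c: "(z3 - z2) * R $ k $ j = (z2 - z1) * R $ i $ k"
    "(z4 - z3) * R $ i $ k = (z3 - z2) * R $ j $ i"
    "(z5 - z4) * R $ j $ i = (z4 - z3) * R $ k $ j"
    using R_skew[of k i] R_skew[of i j] R_skew[of j k] by simp_all
  have "(z5 - z4) * (R $ j $ i * R $ i $ k) = (z4 - z3) * R $ k $ j * R $ i $ k"
    by (simp only: c(3) mult.assoc[symmetric])
  also have "\<dots> = (z4 - z3) * R $ i $ k * R $ k $ j" by (simp only: ac_simps)
  also have "\<dots> = (z3 - z2) * R $ k $ j * R $ j $ i" by (simp only: c(2)) (simp only: ac_simps)
  also have "\<dots> = (z2 - z1) * (R $ j $ i * R $ i $ k)" by (simp only: c(1)) (simp only: ac_simps)
  finally have period: "z5 - z4 = z2 - z1" using rates \<open>i' = i\<close> by simp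
  let ?w = "axis_arc i (z2 - z1) \<odot> axis_arc j (z3 - z2) \<odot> axis_arc k (z4 - z3) \<odot> axis_arc i (z2 - z1) \<odot> axis_arc j (z6 - z5)"
  have "q z6 = q z1 \<odot> ?w"
    using face_arc_q[OF i] face_arc_q[OF j] face_arc_q[OF k] face_arc_q[OF i'] face_arc_q[OF j']
    by (simp add: carnot_mult_assoc period \<open>i' = i\<close> \<open>j' = j\<close>)
  moreover have "?w \<in> interior arc_products"
    using z2 z3 z4 z6 by (intro five_arcs_interior[OF ijk]) auto
  moreover have "q z1 \<in> arc_products"
    using q_arc_product[OF fin, of 0 z1] extremal z1 S_le by (auto simp: extremal_def trajectory_def)
  moreover obtain r where "r \<in> arc_products" "q T = q z6 \<odot> r"
    using q_arc_product[OF fin, of z6 T] z1 z2 z3 z4 z5 z6 S_le[OF z6(1)] by auto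
  ultimately show ?thesis using interior_arc_products_mult by auto
qed

end

theorem proposition4:
  fixes T :: real and u :: "real \<Rightarrow> real^3" and q :: "real \<Rightarrow> carnot"
    and h :: "real \<Rightarrow> real^3" and R :: "real^3^3"
  assumes "extremal T u q h R"
    and "bang_bang T h"
    and "card (switchings T u) > 4"
  shows "q T \<in> interior attainable_set"
proof -
  have "switchings T u \<noteq> {}" using assms(3) by auto
  then have "0 < T" by (auto simp: switchings_def)
  with assms(1) interpret extremal_curve T u q h R by unfold_locales
  have fin: "finite {t \<in> {0..T}. h t \<in> Q_edges}" using assms(2) by (simp add: bang_bang_def)
  then have "finite {t \<in> {0<..<T}. h t \<in> Q_edges}"
    by (rule finite_subset[rotated]) auto
  then have "card (switchings T u) \<le> card {t \<in> {0<..<T}. h t \<in> Q_edges}"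
    using switchings_subset by (rule card_mono)
  then have "q T \<in> interior arc_products"
    using assms(3) fin by (intro five_edge_points_interior) auto
  then show ?thesis using interior_mono[OF arc_products_attainable] by blast
qed

end
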